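(* Let $1\le k\le n$ be integers and $\alpha\in(0,1)$. Let $p_1,\ldots,p_n$ be $p$-values for null hypotheses $H_1,\ldots,H_n$, and suppose that $p_1,\ldots,p_n$ are independent and that those corresponding to the true null hypotheses are i.i.d. $U(0,1)$. Consider Procedure 1: reject $H_{(1)},\ldots,H_{(\hat l)}$, where $$\hat l=\max\left\{1\le i\le n:\ p_{i:n}\,G(k-1,n-1,p_{i:n})\le \frac{i\alpha}{n}\right\},$$ if the maximum exists, and otherwise reject no hypothesis. Then Procedure 1 controls the $k$-FDR at $\alpha$, i.e. $k\text{-FDR}\le\alpha$.
   Context: A fixed (deterministic) subset of $H_1,\ldots,H_n$ consists of true null hypotheses and the rest are false; $p$-values take values in $[0,1]$, and those of false null hypotheses have arbitrary distributions. $p_{1:n}\le\cdots\le p_{n:n}$ are the ordered $p$-values and $H_{(i)}$ is the null hypothesis corresponding to $p_{i:n}$. For integers $0\le k\le n$, $$G(k,n,u)=\sum_{j=k}^n\binom nj u^j(1-u)^{n-j}.$$ For a multiple testing procedure, let $V_n$ be the number of true null hypotheses rejected (false rejections) and $R_n$ the total number of rejections. Then $$k\text{-FDR}=E\left\{\frac{V_n\,I(V_n\ge k)}{\max(R_n,1)}\right\},$$ where $I(A)$ is the indicator of the event $A$. *)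

theory Defs
  imports "HOL-Probability.Probability"
begin

definition G :: "nat \<Rightarrow> nat \<Rightarrow> real \<Rightarrow> real" where
  "G k n u = (\<Sum>j = k..n. real (n choose j) * u ^ j * (1 - u) ^ (n - j))"

text \<open>Hypotheses are indexed by \<open>{1..n}\<close>, and \<open>order_stat n x i\<close> is the \<open>i\<close>-th smallest of
  \<open>x 1, \<dots>, x n\<close>, counted with multiplicity; it is meaningful for \<open>1 \<le> i \<le> n\<close> only.\<close>

definition order_stat :: "nat \<Rightarrow> (nat \<Rightarrow> real) \<Rightarrow> nat \<Rightarrow> real" where
  "order_stat n x i = sort (map x [1..<Suc n]) ! (i - 1)"

text \<open>\<open>H\<^bsub>(i)\<^esub>\<close> is the hypothesis with index \<open>\<sigma> i\<close>. With tied p-values there are several such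
  \<open>\<sigma>\<close>, i.e. several ways of breaking the ties.\<close>

definition orders_hypotheses :: "nat \<Rightarrow> (nat \<Rightarrow> real) \<Rightarrow> (nat \<Rightarrow> nat) \<Rightarrow> bool" where
  "orders_hypotheses n x \<sigma> \<longleftrightarrow>
     bij_betw \<sigma> {1..n} {1..n} \<and> (\<forall>i\<in>{1..n}. x (\<sigma> i) = order_stat n x i)"

text \<open>The value \<open>0\<close> encodes that the maximum does not exist, so that nothing is rejected.\<close>

definition l_hat :: "nat \<Rightarrow> nat \<Rightarrow> real \<Rightarrow> (nat \<Rightarrow> real) \<Rightarrow> nat" where
  "l_hat k n \<alpha> x =
     (let S = {i \<in> {1..n}. order_stat n x i * G (k - 1) (n - 1) (order_stat n x i)
                             \<le> real i * \<alpha> / real n}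
      in if S = {} then 0 else Max S)"

definition procedure1 :: "nat \<Rightarrow> nat \<Rightarrow> real \<Rightarrow> (nat \<Rightarrow> real) \<Rightarrow> (nat \<Rightarrow> nat) \<Rightarrow> nat set" where
  "procedure1 k n \<alpha> x \<sigma> = \<sigma> ` {1..l_hat k n \<alpha> x}"

text \<open>\<open>T\<close> is the set of indices of the true null hypotheses, and \<open>Rej \<omega>\<close> is the set of indices of
  the hypotheses rejected at the outcome \<open>\<omega>\<close>.\<close>

definition kFDR :: "'a measure \<Rightarrow> nat set \<Rightarrow> nat \<Rightarrow> ('a \<Rightarrow> nat set) \<Rightarrow> real" where
  "kFDR M T k Rej =
     (LINT \<omega>|M.
        (let V = card (Rej \<omega> \<inter> T); R = card (Rej \<omega>)
         in real V * of_bool (V \<ge> k) / real (max R 1)))"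

end

theory Submission
  imports Defs
begin

text \<open>Replace each p-value \<open>p i\<close> by its level, the least \<open>l\<close> with
  \<open>p i * G (k - 1) (n - 1) (p i) \<le> l * \<alpha> / n\<close>. The procedure rejects the hypotheses of level at
  most \<open>R\<close>, where \<open>R\<close> is the largest \<open>r\<close> such that at least \<open>r\<close> levels are at most \<open>r\<close>. Fix a true
  null hypothesis \<open>i\<close>, and let \<open>t r\<close> be the probability that its level is at most \<open>r\<close>, so that
  \<open>t r / r = (\<alpha> / n) / G (k - 1) (n - 1) (t r)\<close>. Given that the level of \<open>i\<close> is at most \<open>r\<close>, the event
  \<open>R = r\<close> depends on the other levels only, so \<open>i\<close> contributes at most \<open>\<alpha> / n\<close> times
  \<open>\<Sum>r. prob (R = r \<and> V r \<ge> k - 1) / prob (V r \<ge> k - 1)\<close>, with \<open>V r\<close> the number of other true null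
  hypotheses of level at most \<open>r\<close>. This sum is at most \<open>1\<close> by telescoping, since the conditional
  probability of \<open>R \<ge> r\<close> given \<open>V s \<ge> k - 1\<close> decreases from \<open>s = r - 1\<close> to \<open>s = r\<close>.\<close>

section \<open>Chebyshev's sum inequality and monotonicity of binomial means\<close>

text \<open>Opposite monotonicity makes \<open>(f x - f y) * (g x - g y)\<close> nonpositive.
  Summing it over all pairs with weights \<open>w x * w y\<close> and expanding gives twice the
  claim.\<close>

lemma weighted_Chebyshev_sum:
  fixes f g w :: "nat \<Rightarrow> real"
  assumes "finite Y" and w: "\<And>y. y \<in> Y \<Longrightarrow> 0 \<le> w y"
    and f: "\<And>x y. x \<in> Y \<Longrightarrow> y \<in> Y \<Longrightarrow> x \<le> y \<Longrightarrow> f y \<le> f x"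
    and g: "\<And>x y. x \<in> Y \<Longrightarrow> y \<in> Y \<Longrightarrow> x \<le> y \<Longrightarrow> g x \<le> g y"
  shows "(\<Sum>y\<in>Y. w y * g y * f y) * (\<Sum>y\<in>Y. w y) \<le> (\<Sum>y\<in>Y. w y * f y) * (\<Sum>y\<in>Y. w y * g y)"
proof -
  have "(\<Sum>x\<in>Y. \<Sum>y\<in>Y. w x * w y * ((f x - f y) * (g x - g y))) \<le> 0"
  proof (intro sum_nonpos)
    fix x y assume "x \<in> Y" "y \<in> Y"
    then have "(f x - f y) * (g x - g y) \<le> 0"
      using f[of x y] f[of y x] g[of x y] g[of y x] by (cases "x \<le> y") (auto simp: mult_le_0_iff)
    then show "w x * w y * ((f x - f y) * (g x - g y)) \<le> 0"
      using w \<open>x \<in> Y\<close> \<open>y \<in> Y\<close> by (simp add: mult_le_0_iff)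
  qed
  also have "(\<Sum>x\<in>Y. \<Sum>y\<in>Y. w x * w y * ((f x - f y) * (g x - g y)))
      = (\<Sum>x\<in>Y. \<Sum>y\<in>Y. (w x * g x * f x) * w y) + (\<Sum>x\<in>Y. \<Sum>y\<in>Y. w x * (w y * g y * f y))
        - (\<Sum>x\<in>Y. \<Sum>y\<in>Y. (w x * f x) * (w y * g y)) - (\<Sum>x\<in>Y. \<Sum>y\<in>Y. (w x * g x) * (w y * f y))"
    unfolding sum.distrib[symmetric] sum_subtractf[symmetric]
    by (intro sum.cong refl) (simp add: algebra_simps)
  finally show ?thesis
    unfolding sum_product[symmetric] by (simp add: algebra_simps)
qed

text \<open>Pascal's rule, in the form needed for inductions that split off one trial.\<close>

lemma sum_binomial_Suc:
  fixes z :: "nat \<Rightarrow> real"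
  shows "(\<Sum>y\<le>Suc m. real (Suc m choose y) * z y) = (\<Sum>y\<le>m. real (m choose y) * (z y + z (Suc y)))"
proof -
  have "(\<Sum>y\<le>Suc m. real (Suc m choose y) * z y)
      = z 0 + (\<Sum>y\<le>m. real ((m choose y) + (m choose Suc y)) * z (Suc y))"
    by (simp only: sum.atMost_Suc_shift binomial_Suc_Suc) simp
  also have "\<dots> = (\<Sum>y\<le>m. real (m choose y) * z (Suc y)) + (\<Sum>y\<le>Suc m. real (m choose y) * z y)"
    by (subst sum.atMost_Suc_shift[of "\<lambda>y. real (m choose y) * z y"]) (simp add: sum.distrib algebra_simps)
  also have "\<dots> = (\<Sum>y\<le>m. real (m choose y) * (z y + z (Suc y)))"
    by (simp add: sum.distrib algebra_simps)
  finally show ?thesis .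
qed

text \<open>The mean of \<open>\<psi>\<close> at a binomial variable with \<open>m\<close> trials
  and success probability \<open>q\<close>. Conditioning on one trial suits the inductions below
  better than the explicit sum.\<close>

primrec binomial_mean :: "real \<Rightarrow> (nat \<Rightarrow> real) \<Rightarrow> nat \<Rightarrow> real" where
  "binomial_mean q \<psi> 0 = \<psi> 0"
| "binomial_mean q \<psi> (Suc m) = q * binomial_mean q (\<lambda>j. \<psi> (Suc j)) m + (1 - q) * binomial_mean q \<psi> m"

lemma binomial_mean_eq_sum:
  "binomial_mean q \<psi> m = (\<Sum>j\<le>m. real (m choose j) * (q ^ j * (1 - q) ^ (m - j) * \<psi> j))"
proof (induction m arbitrary: \<psi>)
  case (Suc m)
  have "binomial_mean q \<psi> (Suc m) = (\<Sum>j\<le>m. real (m choose j) *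
      (q ^ j * (1 - q) ^ (Suc m - j) * \<psi> j + q ^ Suc j * (1 - q) ^ (Suc m - Suc j) * \<psi> (Suc j)))"
    unfolding binomial_mean.simps Suc.IH sum_distrib_left sum.distrib[symmetric]
    by (intro sum.cong) (auto simp: Suc_diff_le algebra_simps)
  then show ?case
    by (subst sum_binomial_Suc) simp
qed simp

lemma G_eq_binomial_mean: "G c m u = binomial_mean u (\<lambda>j. of_bool (c \<le> j)) m"
  unfolding G_def binomial_mean_eq_sum
  by (rule sum.mono_neutral_cong_left) auto

lemma binomial_mean_mono_fun:
  assumes "0 \<le> q" "q \<le> 1" "\<And>j. \<psi> j \<le> \<phi> j"
  shows "binomial_mean q \<psi> m \<le> binomial_mean q \<phi> m"
  using assms(3)
  by (induction m arbitrary: \<psi> \<phi>) (auto intro!: add_mono mult_left_mono simp: assms(1,2))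

text \<open>The mean for \<open>Suc m\<close> trials is a convex combination of the means of
  \<open>\<psi>\<close> and of its shift for \<open>m\<close> trials, and the shift has the larger
  mean.\<close>

lemma mono_binomial_mean:
  assumes "0 \<le> q" "q \<le> 1" "mono \<psi>"
  shows "mono (binomial_mean q \<psi>)"
proof (rule incseq_SucI)
  fix m
  have "binomial_mean q \<psi> m \<le> binomial_mean q (\<lambda>j. \<psi> (Suc j)) m"
    using assms by (intro binomial_mean_mono_fun) (auto intro: monoD)
  from mult_left_mono[OF this assms(1)]
  show "binomial_mean q \<psi> m \<le> binomial_mean q \<psi> (Suc m)"
    by (simp add: algebra_simps)
qed

text \<open>The induction hypothesis raises \<open>p\<close> to \<open>q\<close> in the two inner
  means; raising the outer weight then moves mass to the larger of the two.\<close>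

lemma binomial_mean_mono_prob:
  assumes "0 \<le> p" "p \<le> q" "q \<le> 1" "mono \<psi>"
  shows "binomial_mean p \<psi> m \<le> binomial_mean q \<psi> m"
  using assms(4)
proof (induction m arbitrary: \<psi>)
  case (Suc m)
  have Suc_mono: "mono (\<lambda>j. \<psi> (Suc j))"
    using Suc.prems by (auto simp: mono_def)
  have le: "binomial_mean q \<psi> m \<le> binomial_mean q (\<lambda>j. \<psi> (Suc j)) m"
    using assms Suc.prems by (intro binomial_mean_mono_fun) (auto intro: monoD)
  have "binomial_mean p \<psi> (Suc m)
      \<le> p * binomial_mean q (\<lambda>j. \<psi> (Suc j)) m + (1 - p) * binomial_mean q \<psi> m"
    using assms by (auto intro!: add_mono mult_left_mono Suc.IH Suc_mono Suc.prems)
  also have "\<dots> \<le> binomial_mean q \<psi> (Suc m)"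
    using mult_right_mono[OF assms(2), of "binomial_mean q (\<lambda>j. \<psi> (Suc j)) m - binomial_mean q \<psi> m"] le
    by (simp add: algebra_simps)
  finally show ?case .
qed simp

lemma mono_of_bool_le: "mono (\<lambda>j. of_bool ((c::nat) \<le> j) :: real)"
  by (auto simp: mono_def)

lemma G_mono: "0 \<le> u \<Longrightarrow> u \<le> v \<Longrightarrow> v \<le> 1 \<Longrightarrow> G c m u \<le> G c m v"
  unfolding G_eq_binomial_mean by (rule binomial_mean_mono_prob[OF _ _ _ mono_of_bool_le])

text \<open>Compares the tail for the actual number of other true null hypotheses with the tail for
  \<open>n - 1\<close> trials in the procedure.\<close>

lemma G_mono_trials: "0 \<le> u \<Longrightarrow> u \<le> 1 \<Longrightarrow> m \<le> m' \<Longrightarrow> G c m u \<le> G c m' u"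
  unfolding G_eq_binomial_mean by (rule monoD[OF mono_binomial_mean[OF _ _ mono_of_bool_le]])

lemma G_nonneg: "0 \<le> u \<Longrightarrow> u \<le> 1 \<Longrightarrow> 0 \<le> G c m u"
  unfolding G_def by (intro sum_nonneg) auto

lemma G_pos: "0 < u \<Longrightarrow> u \<le> 1 \<Longrightarrow> c \<le> m \<Longrightarrow> 0 < G c m u"
  unfolding G_def by (rule sum_pos2[of _ m]) auto

lemma G_one: "c \<le> m \<Longrightarrow> G c m 1 = 1"
proof -
  assume "c \<le> m"
  then have "G c m 1 = (\<Sum>j\<in>{c..m}. if j = m then 1 else 0)"
    unfolding G_def by (intro sum.cong) (auto simp: power_0_left)
  then show ?thesis using \<open>c \<le> m\<close> by simp
qed

lemma continuous_on_G: "continuous_on A (G c m)"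
  unfolding G_def[abs_def] by (intro continuous_intros)

subsection \<open>Samples of independent draws\<close>

definition num_in :: "'b set \<Rightarrow> 'b multiset \<Rightarrow> nat" where
  "num_in A M = size (filter_mset (\<lambda>x. x \<in> A) M)"

lemma num_in_simps [simp]:
  "num_in A {#} = 0"
  "num_in A (add_mset x M) = (if x \<in> A then Suc (num_in A M) else num_in A M)"
  "num_in A (M + N) = num_in A M + num_in A N"
  by (auto simp: num_in_def)

lemma num_in_image_mset_set:
  "finite I \<Longrightarrow> num_in A (image_mset f (mset_set I)) = card {i \<in> I. f i \<in> A}"
proof (induction rule: finite_induct)
  case (insert i I)
  have "{j \<in> insert i I. f j \<in> A} = (if f i \<in> A then insert i {j \<in> I. f j \<in> A} else {j \<in> I. f j \<in> A})"
    by auto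
  with insert show ?case by auto
qed auto

text \<open>The expectation of \<open>F\<close> at the multiset of \<open>m\<close> independent draws from \<open>K\<close> with weights \<open>w\<close>.
  The weights need not add up to \<open>1\<close>, so that draws can be confined to a subset of \<open>K\<close>.\<close>

primrec mean_sample :: "'b set \<Rightarrow> ('b \<Rightarrow> real) \<Rightarrow> nat \<Rightarrow> ('b multiset \<Rightarrow> real) \<Rightarrow> real" where
  "mean_sample K w 0 F = F {#}"
| "mean_sample K w (Suc m) F = (\<Sum>x\<in>K. w x * mean_sample K w m (\<lambda>M. F (add_mset x M)))"

lemma mean_sample_mono:
  assumes "\<And>x. x \<in> K \<Longrightarrow> 0 \<le> w x" and "\<And>M. F M \<le> H M"
  shows "mean_sample K w m F \<le> mean_sample K w m H"
  using assms(2)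
  by (induction m arbitrary: F H) (auto intro!: sum_mono mult_left_mono simp: assms(1))

lemma mean_sample_add:
  "mean_sample K w m (\<lambda>M. F M + H M) = mean_sample K w m F + mean_sample K w m H"
  by (induction m arbitrary: F H) (auto simp: algebra_simps sum.distrib)

lemma mean_sample_cmult: "mean_sample K w m (\<lambda>M. a * F M) = a * mean_sample K w m F"
  by (induction m arbitrary: F) (auto simp: algebra_simps sum_distrib_left)

lemma mean_sample_const: "mean_sample K w m (\<lambda>M. a) = sum w K ^ m * a"
  by (induction m) (simp_all add: sum_distrib_right[symmetric] mult.assoc)

lemma mean_sample_diff:
  "mean_sample K w m (\<lambda>M. F M - H M) = mean_sample K w m F - mean_sample K w m H"
  using mean_sample_add[of K w m F "\<lambda>M. (-1) * H M"] mean_sample_cmult[of K w m "-1" H] by simp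

text \<open>Given the number of draws in \<open>B\<close>, the number of draws in \<open>A \<subseteq> B\<close> is binomial.\<close>

lemma mean_sample_thinning:
  assumes K: "finite K" "A \<subseteq> B" "B \<subseteq> K" and q: "sum w A = q * sum w B"
    and F: "\<And>x M. x \<in> B \<Longrightarrow> F (add_mset x M) = F (add_mset b M)"
  shows "mean_sample K w m (\<lambda>M. F M * \<psi> (num_in A M))
       = mean_sample K w m (\<lambda>M. F M * binomial_mean q \<psi> (num_in B M))"
  using F
proof (induction m arbitrary: F \<psi>)
  case (Suc m)
  have IH: "mean_sample K w m (\<lambda>M. F (add_mset x M) * \<phi> (num_in A M))
      = mean_sample K w m (\<lambda>M. F (add_mset x M) * binomial_mean q \<phi> (num_in B M))" for x \<phi>
    using Suc.prems by (intro Suc.IH) (metis add_mset_commute)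
  \<comment> \<open>The first draw lies in \<open>A\<close>, in \<open>B - A\<close> or outside
    \<open>B\<close>. Since \<open>F\<close> does not tell elements of \<open>B\<close> apart, what
    remains after a draw from \<open>B\<close> is some \<open>H \<phi>\<close> that does not depend
    on the draw.\<close>
  define H where "H \<phi> = mean_sample K w m (\<lambda>M. F (add_mset b M) * binomial_mean q \<phi> (num_in B M))" for \<phi>
  have [simp]: "finite B" by (rule finite_subset[OF K(3,1)])
  have split: "(\<Sum>x\<in>K. u x) = (\<Sum>x\<in>A. u x) + (\<Sum>x\<in>B-A. u x) + (\<Sum>x\<in>K-B. u x)" for u :: "_ \<Rightarrow> real"
    using sum.subset_diff[OF K(3,1), of u] sum.subset_diff[OF K(2) \<open>finite B\<close>, of u] by simp
  have B: "mean_sample K w m (\<lambda>M. F (add_mset x M) * binomial_mean q \<phi> (num_in B M)) = H \<phi>"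
    if "x \<in> B" for x \<phi>
    unfolding H_def using Suc.prems[OF that] by simp
  have "mean_sample K w (Suc m) (\<lambda>M. F M * \<psi> (num_in A M))
      = sum w A * H (\<lambda>j. \<psi> (Suc j)) + sum w (B - A) * H \<psi>
        + (\<Sum>x\<in>K-B. w x * mean_sample K w m (\<lambda>M. F (add_mset x M) * binomial_mean q \<psi> (num_in B M)))"
    unfolding mean_sample.simps split sum_distrib_right
  proof (intro arg_cong2[of _ _ _ _ "(+)"] sum.cong refl)
    fix x assume "x \<in> A"
    then show "w x * mean_sample K w m (\<lambda>M. F (add_mset x M) * \<psi> (num_in A (add_mset x M)))
        = w x * H (\<lambda>j. \<psi> (Suc j))"
      using IH[of x "\<lambda>j. \<psi> (Suc j)"] B[of x] K(2) by (simp add: subset_iff)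
  next
    fix x assume "x \<in> B - A"
    then show "w x * mean_sample K w m (\<lambda>M. F (add_mset x M) * \<psi> (num_in A (add_mset x M)))
        = w x * H \<psi>"
      using IH[of x \<psi>] B[of x] by simp
  next
    fix x assume "x \<in> K - B"
    then have "x \<notin> A" using K(2) by blast
    then show "w x * mean_sample K w m (\<lambda>M. F (add_mset x M) * \<psi> (num_in A (add_mset x M)))
        = w x * mean_sample K w m (\<lambda>M. F (add_mset x M) * binomial_mean q \<psi> (num_in B M))"
      using IH[of x \<psi>] by simp
  qed
  also have "sum w (B - A) = sum w B - sum w A"
    using K by (simp add: sum_diff)
  \<comment> \<open>Given a draw in \<open>B\<close>, the weights of \<open>A\<close> and
    \<open>B - A\<close> are \<open>q\<close> and \<open>1 - q\<close>, as in the recursion of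
    \<open>binomial_mean\<close>.\<close>
  also have "sum w A * H (\<lambda>j. \<psi> (Suc j)) + (sum w B - sum w A) * H \<psi>
      = sum w B * (q * H (\<lambda>j. \<psi> (Suc j)) + (1 - q) * H \<psi>)"
    by (simp add: q algebra_simps)
  also have "q * H (\<lambda>j. \<psi> (Suc j)) + (1 - q) * H \<psi>
      = mean_sample K w m (\<lambda>M. F (add_mset b M) * binomial_mean q \<psi> (Suc (num_in B M)))"
    unfolding H_def mean_sample_cmult[symmetric] mean_sample_add[symmetric]
    by (simp add: algebra_simps)
  also have "sum w B * \<dots>
      + (\<Sum>x\<in>K-B. w x * mean_sample K w m (\<lambda>M. F (add_mset x M) * binomial_mean q \<psi> (num_in B M)))
      = mean_sample K w (Suc m) (\<lambda>M. F M * binomial_mean q \<psi> (num_in B M))"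
    unfolding mean_sample.simps(2) sum.subset_diff[OF K(3,1)] sum_distrib_right add.commute[of "sum _ (K - B)"]
    using Suc.prems by (intro arg_cong2[of _ _ _ _ "(+)"] sum.cong) auto
  finally show ?case .
qed (use K in simp)

text \<open>Decomposition by the number \<open>y\<close> of draws in \<open>B\<close>. Those draws
  can be replaced by copies of the representative \<open>b\<close>; the other \<open>m - y\<close>
  are confined to \<open>K - B\<close>, with weights left unnormalised.\<close>

lemma mean_sample_condition:
  assumes K: "finite K" "B \<subseteq> K"
    and F: "\<And>x M. x \<in> B \<Longrightarrow> F (add_mset x M) = F (add_mset b M)"
  shows "mean_sample K w m (\<lambda>M. F M * \<phi> (num_in B M))
       = (\<Sum>y\<le>m. real (m choose y) * (sum w B ^ y * \<phi> y
            * mean_sample (K - B) w (m - y) (\<lambda>M. F (M + replicate_mset y b))))"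
  using F
proof (induction m arbitrary: F \<phi>)
  case (Suc m)
  have IH: "mean_sample K w m (\<lambda>M. F (add_mset x M) * \<phi>' (num_in B M))
      = (\<Sum>y\<le>m. real (m choose y) * (sum w B ^ y * \<phi>' y
            * mean_sample (K - B) w (m - y) (\<lambda>M. F (add_mset x (M + replicate_mset y b)))))" for x \<phi>'
    using Suc.prems by (intro Suc.IH) (metis add_mset_commute)
  have "mean_sample K w (Suc m) (\<lambda>M. F M * \<phi> (num_in B M))
      = (\<Sum>x\<in>B. w x * mean_sample K w m (\<lambda>M. F (add_mset b M) * \<phi> (Suc (num_in B M))))
      + (\<Sum>x\<in>K-B. w x * mean_sample K w m (\<lambda>M. F (add_mset x M) * \<phi> (num_in B M)))"
    unfolding mean_sample.simps(2) sum.subset_diff[OF K(2,1)] add.commute[of "sum _ (K - B)"]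
    using Suc.prems by (intro arg_cong2[of _ _ _ _ "(+)"] sum.cong) auto
  also have "\<dots> = (\<Sum>y\<le>m. real (m choose y) * (
        sum w B ^ Suc y * \<phi> (Suc y) * mean_sample (K - B) w (m - y) (\<lambda>M. F (M + replicate_mset (Suc y) b))
        + sum w B ^ y * \<phi> y * (\<Sum>x\<in>K-B. w x
            * mean_sample (K - B) w (m - y) (\<lambda>M. F (add_mset x M + replicate_mset y b)))))"
    unfolding IH[of _ \<phi>] IH[of _ "\<lambda>y. \<phi> (Suc y)"]
    unfolding sum_distrib_left sum_distrib_right distrib_left sum.distrib
    by (subst (1 2) sum.swap) (simp add: algebra_simps sum_distrib_left sum_distrib_right)
  also have "\<dots> = (\<Sum>y\<le>Suc m. real (Suc m choose y) * (sum w B ^ y * \<phi> y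
            * mean_sample (K - B) w (Suc m - y) (\<lambda>M. F (M + replicate_mset y b))))"
    by (subst sum_binomial_Suc) (intro sum.cong, auto simp: Suc_diff_le)
  finally show ?case .
qed simp

text \<open>Conditioning with the constant \<open>F = 1\<close> leaves only the binomial
  weights.\<close>

lemma mean_sample_num_in:
  assumes "finite K" "B \<subseteq> K" "sum w K = 1"
  shows "mean_sample K w m (\<lambda>M. of_bool (c \<le> num_in B M)) = G c m (sum w B)"
proof -
  have KB: "sum w (K - B) = 1 - sum w B"
    using assms by (simp add: sum_diff finite_subset)
  have "mean_sample K w m (\<lambda>M. of_bool (c \<le> num_in B M))
      = mean_sample K w m (\<lambda>M. 1 * of_bool (c \<le> num_in B M))" by simp
  also have "\<dots> = G c m (sum w B)"
    unfolding mean_sample_condition[OF assms(1,2), where F = "\<lambda>_. 1" and \<phi> = "\<lambda>y. of_bool (c \<le> y)", OF refl]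
      mean_sample_const KB G_eq_binomial_mean binomial_mean_eq_sum
    by (intro sum.cong) auto
  finally show ?thesis .
qed

text \<open>Conditionally on \<open>num_in B M = y\<close>, the mean of \<open>F\<close> is antitone in \<open>y\<close> and
  the probability of \<open>num_in A M \<ge> c\<close> is monotone in \<open>y\<close> and vanishes for \<open>y < c\<close>; so this is
  Chebyshev's sum inequality on \<open>{c..m}\<close>.\<close>

lemma mean_sample_tail_ratio:
  assumes K: "finite K" "A \<subseteq> B" "B \<subseteq> K" "b \<in> B" and w: "\<And>x. x \<in> K \<Longrightarrow> 0 \<le> w x" "sum w K = 1"
    and B: "0 < sum w B" "sum w B < 1"
    and F: "\<And>x M. x \<in> B \<Longrightarrow> F (add_mset x M) = F (add_mset b M)"
    and F_le: "\<And>x M. x \<in> K \<Longrightarrow> F (add_mset b M) \<le> F (add_mset x M)"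
  shows "mean_sample K w m (\<lambda>M. F M * of_bool (c \<le> num_in A M)) * G c m (sum w B)
       \<le> mean_sample K w m (\<lambda>M. F M * of_bool (c \<le> num_in B M)) * G c m (sum w A)"
proof -
  define t where "t = sum w B"
  \<comment> \<open>The conditional probability of \<open>A\<close> given \<open>B\<close>;
    \<open>\<beta> y\<close> below is the conditional probability of
    \<open>c \<le> num_in A M\<close> given \<open>num_in B M = y\<close>.\<close>
  define q where "q = sum w A / t"
  have t: "0 < t" "t < 1" and qt: "sum w A = q * sum w B"
    using B by (auto simp: t_def q_def)
  have "0 \<le> sum w A" using K w by (intro sum_nonneg) auto
  moreover have "sum w A \<le> t"
    unfolding t_def using K w by (intro sum_mono2) (auto intro: finite_subset)
  ultimately have q: "0 \<le> q" "q \<le> 1" using t by (auto simp: q_def)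
  define \<beta> where "\<beta> = binomial_mean q (\<lambda>j. of_bool (c \<le> j))"
  have \<beta>_mono: "mono \<beta>" unfolding \<beta>_def by (rule mono_binomial_mean[OF q mono_of_bool_le])
  have \<beta>_0: "\<beta> y = 0" if "y < c" for y
    using that by (simp add: \<beta>_def binomial_mean_eq_sum)
  have KB: "sum w (K - B) = 1 - t"
    using K w by (simp add: sum_diff t_def finite_subset)
  define u where "u y = mean_sample (K - B) w (m - y) (\<lambda>M. F (M + replicate_mset y b))" for y
  \<comment> \<open>Normalising by the probability that \<open>m - y\<close> draws avoid
    \<open>B\<close> turns \<open>u y\<close> into the conditional mean of \<open>F\<close>; the
    binomial weights go into \<open>\<pi>\<close>.\<close>
  define f where "f y = u y / (1 - t) ^ (m - y)" for y
  define \<pi> where "\<pi> y = real (m choose y) * t ^ y * (1 - t) ^ (m - y)" for y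
  \<comment> \<open>Trading one copy of \<open>b\<close> for a draw outside \<open>B\<close> cannot
    decrease \<open>F\<close>, by \<open>F_le\<close>.\<close>
  have f_step: "f (Suc y) \<le> f y" if "y < m" for y
  proof -
    define d where "d = m - Suc y"
    have d: "m - y = Suc d" "m - Suc y = d" using that by (auto simp: d_def)
    have "(1 - t) * u (Suc y) = (\<Sum>x\<in>K-B. w x * u (Suc y))"
      by (simp add: KB sum_distrib_right[symmetric])
    also have "\<dots> \<le> u y"
      unfolding u_def d mean_sample.simps using w F_le
      by (intro sum_mono mult_left_mono mean_sample_mono) (auto simp: add_mset_commute)
    finally have "(1 - t) * u (Suc y) / (1 - t) ^ Suc d \<le> u y / (1 - t) ^ Suc d"
      using t by (intro divide_right_mono) auto
    then show ?thesis using t by (simp add: f_def d)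
  qed
  have f_anti: "f y \<le> f x" if "x \<le> y" "y \<le> m" for x y
    using that by (induction rule: dec_induct) (auto intro: order_trans[OF f_step])
  have cond: "mean_sample K w m (\<lambda>M. F M * \<phi> (num_in B M)) = (\<Sum>y\<in>{c..m}. \<pi> y * \<phi> y * f y)"
    if "\<And>y. y < c \<Longrightarrow> \<phi> y = 0" for \<phi>
  proof -
    have "mean_sample K w m (\<lambda>M. F M * \<phi> (num_in B M))
        = (\<Sum>y\<le>m. real (m choose y) * (sum w B ^ y * \<phi> y * u y))"
      unfolding u_def by (rule mean_sample_condition[OF K(1,3)]) (rule F)
    also have "\<dots> = (\<Sum>y\<in>{c..m}. \<pi> y * \<phi> y * f y)"
      using that t by (intro sum.mono_neutral_cong_right) (auto simp: f_def \<pi>_def t_def)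
    finally show ?thesis .
  qed
  have 1: "mean_sample K w m (\<lambda>M. F M * of_bool (c \<le> num_in A M)) = (\<Sum>y\<in>{c..m}. \<pi> y * \<beta> y * f y)"
    using mean_sample_thinning[where F = F, OF K(1-3) qt F, where \<psi> = "\<lambda>j. of_bool (c \<le> j)"] cond[OF \<beta>_0]
    by (simp add: \<beta>_def)
  have 2: "mean_sample K w m (\<lambda>M. F M * of_bool (c \<le> num_in B M)) = (\<Sum>y\<in>{c..m}. \<pi> y * f y)"
    using cond[of "\<lambda>y. of_bool (c \<le> y)"] by simp
  have 3: "G c m (sum w B) = (\<Sum>y\<in>{c..m}. \<pi> y)"
    by (simp add: G_def \<pi>_def t_def)
  have "G c m (sum w A) = mean_sample K w m (\<lambda>M. 1 * \<beta> (num_in B M))"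
    using mean_sample_thinning[OF K(1-3) qt, where F = "\<lambda>_. 1" and \<psi> = "\<lambda>j. of_bool (c \<le> j)"]
      mean_sample_num_in[of K A w m c] K w by (auto simp: \<beta>_def)
  also have "\<dots> = (\<Sum>y\<in>{c..m}. \<pi> y * \<beta> y)"
    unfolding mean_sample_condition[where F = "\<lambda>_. 1" and \<phi> = \<beta>, OF K(1,3) refl] mean_sample_const KB
    using \<beta>_0 by (intro sum.mono_neutral_cong_right) (auto simp: \<pi>_def t_def)
  finally show ?thesis
    unfolding 1 2 3 using t f_anti \<beta>_mono
    by (auto intro!: weighted_Chebyshev_sum simp: \<pi>_def monoD)
qed

text \<open>With \<open>S r\<close> the event that the step-up condition fails at all levels above \<open>r\<close>, the \<open>r\<close>-th
  summand is \<open>(P r - Q r) / G c m (t r)\<close>, where \<open>P r\<close> and \<open>Q r\<close> are the probabilities of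
  \<open>c \<le> num_in {..r} M\<close> together with \<open>S r\<close> and \<open>S (r - 1)\<close>, respectively. The tail ratio inequality gives
  \<open>P (r - 1) / G c m (t (r - 1)) \<le> Q r / G c m (t r)\<close>, so that the sum telescopes.\<close>

lemma step_up_sum_le_1:
  fixes w :: "nat \<Rightarrow> real" and N :: "nat multiset"
  assumes w: "\<And>x. 0 \<le> w x" "sum w {..Suc n} = 1"
    and t: "\<And>r. 1 \<le> r \<Longrightarrow> r \<le> n \<Longrightarrow> 0 < sum w {..r}" "\<And>r. r \<le> n \<Longrightarrow> sum w {..r} < 1"
    and m: "m \<le> m'" "c \<le> m'"
  shows "(\<Sum>r=1..n. mean_sample {..Suc n} w m (\<lambda>M. of_bool (r \<le> Suc (num_in {..r} (M + N))
             \<and> (\<forall>l\<in>{r<..n}. Suc (num_in {..l} (M + N)) < l) \<and> c \<le> num_in {..r} M))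
           / G c m' (sum w {..r})) \<le> 1"
proof -
  define t where "t r = sum w {..r}" for r
  define S where "S r M \<longleftrightarrow> (\<forall>l\<in>{r<..n}. Suc (num_in {..l} (M + N)) < l)" for r M
  define P where "P r = mean_sample {..Suc n} w m (\<lambda>M. of_bool (S r M) * of_bool (c \<le> num_in {..r} M))" for r
  define Q where "Q r = mean_sample {..Suc n} w m (\<lambda>M. of_bool (S (r - 1) M) * of_bool (c \<le> num_in {..r} M))" for r
  define Z where "Z r = mean_sample {..Suc n} w m (\<lambda>M. of_bool (r \<le> Suc (num_in {..r} (M + N))
             \<and> S r M \<and> c \<le> num_in {..r} M))" for r
  have nonneg: "0 \<le> mean_sample {..Suc n} w m (\<lambda>M. of_bool (X M))" for X
    using mean_sample_mono[of "{..Suc n}" w "\<lambda>_. 0" "\<lambda>M. of_bool (X M)" m] w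
    by (simp add: mean_sample_const)
  have Z: "Z r = P r - Q r" if "1 \<le> r" "r \<le> n" for r
  proof -
    have "{r - 1<..n} = insert r {r<..n}" using that by auto
    then have "S (r - 1) M \<longleftrightarrow> \<not> r \<le> Suc (num_in {..r} (M + N)) \<and> S r M" for M
      unfolding S_def by auto
    then show ?thesis
      unfolding Z_def P_def Q_def mean_sample_diff[symmetric]
      by (intro arg_cong[where f = "mean_sample _ _ _"] ext) auto
  qed
  have t_bounds: "0 \<le> t r" "r \<le> n \<Longrightarrow> t r < 1" "1 \<le> r \<Longrightarrow> r \<le> n \<Longrightarrow> 0 < t r" for r
    using t w by (auto simp: t_def intro: sum_nonneg)
  have tail: "mean_sample {..Suc n} w m (\<lambda>M. of_bool (c \<le> num_in {..r} M)) = G c m (t r)" if "r \<le> n" for r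
    unfolding t_def using that w by (intro mean_sample_num_in) auto
  have "(\<Sum>r=1..n. Z r / G c m' (t r)) \<le> 1"
  \<comment> \<open>With fewer than \<open>c\<close> draws the tail is an empty sum, so every
    numerator is at most \<open>0\<close>. Otherwise \<open>G c m (t r)\<close> is positive for
    \<open>1 \<le> r\<close> and can serve as denominator.\<close>
  proof (cases "c \<le> m")
    case False
    have "Z r / G c m' (t r) \<le> 0" if "r \<in> {1..n}" for r
    proof -
      have "Z r \<le> mean_sample {..Suc n} w m (\<lambda>M. of_bool (c \<le> num_in {..r} M))"
        unfolding Z_def using w by (intro mean_sample_mono) auto
      also have "\<dots> = 0"
        using that False by (simp add: tail G_def)
      finally show ?thesis
        using that t_bounds[of r] G_nonneg[of "t r" c m'] by (auto simp: divide_le_0_iff)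
    qed
    then have "(\<Sum>r=1..n. Z r / G c m' (t r)) \<le> 0" by (rule sum_nonpos)
    then show ?thesis by simp
  next
    case True
    have g_pos: "0 < G c m (t r)" if "1 \<le> r" "r \<le> n" for r
      using that True t_bounds[of r] by (intro G_pos) auto
    have step: "P r / G c m (t r) \<le> Q (Suc r) / G c m (t (Suc r))" if "Suc r \<le> n" for r
    proof (cases "r = 0")
      case True
      have "\<not> S 0 M" for M
        using that by (auto simp: S_def intro!: bexI[of _ 1])
      then have "P r = 0"
        using True by (simp add: P_def mean_sample_const)
      moreover have "0 \<le> Q (Suc r)"
        using nonneg[of "\<lambda>M. S r M \<and> c \<le> num_in {..Suc r} M"] by (simp add: Q_def of_bool_conj)
      ultimately show ?thesis
        using g_pos[of "Suc r"] that by simp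
    next
      case False
      have "P r * G c m (t (Suc r)) \<le> Q (Suc r) * G c m (t r)"
        unfolding P_def Q_def t_def diff_Suc_1
      proof (rule mean_sample_tail_ratio)
        \<comment> \<open>\<open>S r\<close> inspects only the counts in \<open>{..l}\<close> with
          \<open>l > r\<close>. All elements of \<open>{..Suc r}\<close> enter every such count, so
          \<open>Suc r\<close> represents them, and no other draw makes \<open>S r\<close> harder to
          satisfy.\<close>
        show "of_bool (S r (add_mset x M)) = (of_bool (S r (add_mset (Suc r) M)) :: real)"
          if "x \<in> {..Suc r}" for x M
          using that by (auto simp: S_def)
        show "of_bool (S r (add_mset (Suc r) M)) \<le> (of_bool (S r (add_mset x M)) :: real)" for x M
          by (auto simp: S_def split: if_splits)
      qed (use that w t_bounds[of "Suc r"] in \<open>auto simp: t_def simp del: sum.atMost_Suc\<close>)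
      then show ?thesis
        using g_pos[of r] g_pos[of "Suc r"] that False by (simp add: divide_simps mult.commute)
    qed
    have sum_le: "(\<Sum>r=1..j. (P r - Q r) / G c m (t r)) \<le> P j / G c m (t j)" if "j \<le> n" for j
      using that
    proof (induction j)
      case 0
      have "0 \<le> P 0"
        using nonneg[of "\<lambda>M. S 0 M \<and> c \<le> num_in {..0} M"] by (simp add: P_def of_bool_conj)
      then show ?case
        using G_nonneg[of "t 0" c m] t_bounds[of 0] by simp
    next
      case (Suc j)
      then show ?case
        using step[of j] by (simp add: diff_divide_distrib)
    qed
    have "(\<Sum>r=1..n. Z r / G c m' (t r)) \<le> (\<Sum>r=1..n. (P r - Q r) / G c m (t r))"
    proof (rule sum_mono)
      fix r assume r: "r \<in> {1..n}"
      have "0 \<le> Z r"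
        unfolding Z_def by (rule nonneg)
      moreover have "G c m (t r) \<le> G c m' (t r)"
        using r t_bounds[of r] m by (intro G_mono_trials) auto
      ultimately show "Z r / G c m' (t r) \<le> (P r - Q r) / G c m (t r)"
        using r Z[of r] g_pos[of r] by (auto intro!: divide_left_mono)
    qed
    also have "\<dots> \<le> P n / G c m (t n)"
      by (rule sum_le) simp
    \<comment> \<open>\<open>S n\<close> is vacuous, so \<open>P n\<close> equals
      \<open>G c m (t n)\<close>.\<close>
    also have "\<dots> \<le> 1"
      using tail[of n] t_bounds[of n] G_nonneg[of "t n" c m] by (simp add: P_def S_def)
    finally show ?thesis .
  qed
  then show ?thesis
    by (simp only: Z_def S_def t_def)
qed

subsection \<open>Finite product laws\<close>

definition mean_prod :: "'i set \<Rightarrow> 'b set \<Rightarrow> ('i \<Rightarrow> 'b \<Rightarrow> real) \<Rightarrow> (('i \<Rightarrow> 'b) \<Rightarrow> real) \<Rightarrow> real" where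
  "mean_prod I K w F = (\<Sum>f\<in>I \<rightarrow>\<^sub>E K. (\<Prod>i\<in>I. w i (f i)) * F f)"

lemma mean_prod_insert:
  assumes "finite I" "i \<notin> I"
  shows "mean_prod (insert i I) K w F = (\<Sum>x\<in>K. w i x * mean_prod I K w (\<lambda>f. F (f(i := x))))"
proof -
  have inj: "inj_on (\<lambda>(y, g). g(i := y)) (K \<times> (I \<rightarrow>\<^sub>E K))"
    by (rule inj_combinator[OF assms(2)])
  have "mean_prod (insert i I) K w F
      = (\<Sum>(x, f)\<in>K \<times> (I \<rightarrow>\<^sub>E K). (\<Prod>j\<in>insert i I. w j ((f(i := x)) j)) * F (f(i := x)))"
    unfolding mean_prod_def PiE_insert_eq sum.reindex[OF inj] by (simp add: case_prod_unfold)
  also have "\<dots> = (\<Sum>(x, f)\<in>K \<times> (I \<rightarrow>\<^sub>E K). w i x * ((\<Prod>j\<in>I. w j (f j)) * F (f(i := x))))"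
  proof (intro sum.cong refl, clarify)
    fix x f
    have "(\<Prod>j\<in>I. w j ((f(i := x)) j)) = (\<Prod>j\<in>I. w j (f j))"
      using assms(2) by (intro prod.cong) auto
    then show "(\<Prod>j\<in>insert i I. w j ((f(i := x)) j)) * F (f(i := x))
        = w i x * ((\<Prod>j\<in>I. w j (f j)) * F (f(i := x)))"
      using assms by (simp del: fun_upd_apply add: fun_upd_same)
  qed
  finally show ?thesis
    by (simp add: mean_prod_def sum.cartesian_product[symmetric] sum_distrib_left)
qed

lemma mean_prod_mono:
  assumes "\<And>i x. i \<in> I \<Longrightarrow> 0 \<le> w i x" and "\<And>f. F f \<le> H f"
  shows "mean_prod I K w F \<le> mean_prod I K w H"
  unfolding mean_prod_def by (intro sum_mono mult_left_mono prod_nonneg ballI assms)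

lemma mean_prod_cmult: "mean_prod I K w (\<lambda>f. a * F f) = a * mean_prod I K w F"
  by (simp add: mean_prod_def sum_distrib_left algebra_simps)

lemma mean_prod_sum: "mean_prod I K w (\<lambda>f. \<Sum>x\<in>X. F x f) = (\<Sum>x\<in>X. mean_prod I K w (F x))"
  unfolding mean_prod_def sum_distrib_left by (rule sum.swap)

lemma mean_prod_one:
  assumes "finite I" "\<And>i. i \<in> I \<Longrightarrow> sum (w i) K = 1"
  shows "mean_prod I K w (\<lambda>_. 1) = 1"
  using assms by (induction I rule: finite_induct) (simp_all add: mean_prod_insert, simp add: mean_prod_def)

text \<open>The coordinates in \<open>I\<close> are peeled off one at a time; having equal weights
  and entering only through their multiset, they become successive draws of one sample. This
  separates the true null hypotheses from the false ones.\<close>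

lemma mean_prod_iid:
  assumes "finite I" "finite J" "I \<inter> J = {}" and w: "\<And>i. i \<in> I \<Longrightarrow> w i = v"
  shows "mean_prod (I \<union> J) K w (\<lambda>f. F (image_mset f (mset_set I)) (image_mset f (mset_set J)))
    = mean_prod J K w (\<lambda>f. mean_sample K v (card I) (\<lambda>M. F M (image_mset f (mset_set J))))"
  using assms(1,3,4)
proof (induction I arbitrary: F rule: finite_induct)
  case (insert i I)
  have upd: "image_mset (f(i := x)) (mset_set L) = image_mset f (mset_set L)"
    if "i \<notin> L" for L :: "'a set" and f x
    using that by (cases "finite L") (auto intro!: image_mset_cong)
  have "mean_prod (insert i I \<union> J) K w
        (\<lambda>f. F (image_mset f (mset_set (insert i I))) (image_mset f (mset_set J)))
      = (\<Sum>x\<in>K. v x * mean_prod (I \<union> J) K w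
          (\<lambda>f. F (add_mset x (image_mset f (mset_set I))) (image_mset f (mset_set J))))"
    using insert.prems insert.hyps assms(2)
    by (simp add: mean_prod_insert upd)
  also have "\<dots> = (\<Sum>x\<in>K. v x * mean_prod J K w
          (\<lambda>f. mean_sample K v (card I) (\<lambda>M. F (add_mset x M) (image_mset f (mset_set J)))))"
    using insert by (subst insert.IH) auto
  also have "\<dots> = mean_prod J K w (\<lambda>f. mean_sample K v (card (insert i I))
          (\<lambda>M. F M (image_mset f (mset_set J))))"
    using insert.hyps by (simp add: mean_prod_sum mean_prod_cmult)
  finally show ?case .
qed simp

text \<open>The joint values split the space into finitely many cells \<open>E f\<close>, whose
  probabilities factor by independence. Integrability comes with the value of the integral.\<close>

lemma (in prob_space) expectation_indep_vars_finite_range: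
  fixes F :: "('i \<Rightarrow> 'b) \<Rightarrow> real"
  assumes indep: "indep_vars (\<lambda>_. count_space UNIV) X I"
    and fin: "finite I" "finite K" and I: "I \<noteq> {}"
    and K: "\<And>i \<omega>. i \<in> I \<Longrightarrow> \<omega> \<in> space M \<Longrightarrow> X i \<omega> \<in> K"
    and F: "\<And>f g. (\<And>i. i \<in> I \<Longrightarrow> f i = g i) \<Longrightarrow> F f = F g"
  shows "has_bochner_integral M (\<lambda>\<omega>. F (\<lambda>i. X i \<omega>))
           (mean_prod I K (\<lambda>i x. prob (X i -` {x} \<inter> space M)) F)"
proof -
  define E where "E f = (\<Inter>i\<in>I. X i -` {f i} \<inter> space M)" for f
  have X: "random_variable (count_space UNIV) (X i)" if "i \<in> I" for i
    using indep that by (auto simp: indep_vars_def)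
  have E[measurable]: "E f \<in> events" for f
    unfolding E_def using fin I by (intro sets.finite_INT measurable_sets[OF X]) auto
  have "has_bochner_integral M (\<lambda>\<omega>. \<Sum>f\<in>I \<rightarrow>\<^sub>E K. F f * indicator (E f) \<omega>)
      (\<Sum>f\<in>I \<rightarrow>\<^sub>E K. F f * prob (E f))"
    by (intro has_bochner_integral_sum has_bochner_integral_mult_right has_bochner_integral_real_indicator)
      (auto simp: emeasure_eq_measure)
  also have "(\<Sum>f\<in>I \<rightarrow>\<^sub>E K. F f * prob (E f)) = mean_prod I K (\<lambda>i x. prob (X i -` {x} \<inter> space M)) F"
    unfolding mean_prod_def E_def
    by (intro sum.cong refl) (subst indep_varsD_finite[OF indep I fin(1)], auto)
  finally have 1: "has_bochner_integral M (\<lambda>\<omega>. \<Sum>f\<in>I \<rightarrow>\<^sub>E K. F f * indicator (E f) \<omega>)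
      (mean_prod I K (\<lambda>i x. prob (X i -` {x} \<inter> space M)) F)" .
  have "(\<Sum>f\<in>I \<rightarrow>\<^sub>E K. F f * indicator (E f) \<omega>) = F (\<lambda>i. X i \<omega>)" if \<omega>: "\<omega> \<in> space M" for \<omega>
  proof -
    \<comment> \<open>Restricting to \<open>I\<close> makes the observed values an element of
      \<open>I \<rightarrow>\<^sub>E K\<close>, the index of the only cell containing
      \<open>\<omega>\<close>.\<close>
    define g where "g = (\<lambda>i\<in>I. X i \<omega>)"
    have g: "g \<in> I \<rightarrow>\<^sub>E K" using K \<omega> by (auto simp: g_def)
    have "\<omega> \<in> E f \<longleftrightarrow> f = g" if "f \<in> I \<rightarrow>\<^sub>E K" for f
      using that \<omega> I PiE_ext[OF that g] by (auto simp: E_def g_def)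
    then have "(\<Sum>f\<in>I \<rightarrow>\<^sub>E K. F f * indicator (E f) \<omega>) = (\<Sum>f\<in>I \<rightarrow>\<^sub>E K. if f = g then F f else 0)"
      by (intro sum.cong) auto
    also have "\<dots> = F g"
      using g fin by (simp add: finite_PiE)
    also have "\<dots> = F (\<lambda>i. X i \<omega>)"
      by (rule F) (simp add: g_def)
    finally show ?thesis .
  qed
  from has_bochner_integral_cong[THEN iffD1, OF refl this refl 1] show ?thesis .
qed

subsection \<open>Levels and the step-up procedure\<close>

text \<open>The cap \<open>Suc n\<close> keeps the range finite and stands for failing the condition
  at every \<open>l \<le> n\<close>.\<close>

definition level :: "nat \<Rightarrow> nat \<Rightarrow> real \<Rightarrow> real \<Rightarrow> nat" where
  "level k n \<alpha> u = min (Suc n) (nat \<lceil>u * G (k - 1) (n - 1) u * real n / \<alpha>\<rceil>)"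

lemma level_le_iff:
  assumes "0 < \<alpha>" "1 \<le> n" "l \<le> n"
  shows "level k n \<alpha> u \<le> l \<longleftrightarrow> u * G (k - 1) (n - 1) u \<le> real l * \<alpha> / real n"
proof -
  have "level k n \<alpha> u \<le> l \<longleftrightarrow> u * G (k - 1) (n - 1) u * real n / \<alpha> \<le> real l"
    using assms by (auto simp: level_def min_le_iff_disj nat_le_iff ceiling_le_iff)
  also have "\<dots> \<longleftrightarrow> u * G (k - 1) (n - 1) u \<le> real l * \<alpha> / real n"
    using assms by (simp add: field_simps)
  finally show ?thesis .
qed

lemma level_bound: "level k n \<alpha> u \<le> Suc n"
  by (simp add: level_def)

lemma level_mono:
  assumes "0 < \<alpha>" "0 \<le> u" "u \<le> v" "v \<le> 1"
  shows "level k n \<alpha> u \<le> level k n \<alpha> v"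
proof -
  have "u * G (k - 1) (n - 1) u \<le> v * G (k - 1) (n - 1) v"
    using assms by (intro mult_mono G_mono G_nonneg) auto
  then have "u * G (k - 1) (n - 1) u * real n / \<alpha> \<le> v * G (k - 1) (n - 1) v * real n / \<alpha>"
    using assms by (intro divide_right_mono mult_right_mono) auto
  then show ?thesis
    unfolding level_def by (intro min.mono nat_mono ceiling_mono order_refl)
qed

lemma level_measurable: "level k n \<alpha> \<in> measurable borel (count_space UNIV)"
proof -
  have "G (k - 1) (n - 1) \<in> borel_measurable borel"
    by (intro borel_measurable_continuous_onI continuous_on_G)
  then have "(\<lambda>u. \<lceil>u * G (k - 1) (n - 1) u * real n / \<alpha>\<rceil>) \<in> measurable borel (count_space UNIV)"
    by measurable
  then have "(\<lambda>u. (\<lambda>z. min (Suc n) (nat z)) \<lceil>u * G (k - 1) (n - 1) u * real n / \<alpha>\<rceil>)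
      \<in> measurable borel (count_space UNIV)"
    by (rule measurable_compose) simp
  then show ?thesis
    by (simp add: level_def[abs_def])
qed

text \<open>By the intermediate value theorem \<open>u * G (k - 1) (n - 1) u\<close> attains the
  threshold at some \<open>s\<close>, and within the unit interval the level is at most
  \<open>r\<close> exactly up to \<open>s\<close>. Hence \<open>t = s\<close>, which meets the
  threshold with equality.\<close>

lemma uniform_level:
  assumes "1 \<le> k" "k \<le> n" "0 < \<alpha>" "\<alpha> < 1" "1 \<le> r" "r \<le> n"
  defines "t \<equiv> measure (uniform_measure lborel {0<..<1::real}) {u. level k n \<alpha> u \<le> r}"
  shows "0 < t" "t < 1" "t * G (k - 1) (n - 1) t = real r * \<alpha> / real n"
proof -
  define h where "h u = u * G (k - 1) (n - 1) u" for u :: real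
  have target: "0 < real r * \<alpha> / real n" "real r * \<alpha> / real n < 1"
  proof -
    have "real r * \<alpha> \<le> real n * \<alpha>" using assms by simp
    also have "\<dots> < real n" using assms by simp
    finally show "real r * \<alpha> / real n < 1" using assms by simp
  qed (use assms in simp)
  have "continuous_on {0..1} h"
    unfolding h_def by (intro continuous_intros continuous_on_G)
  moreover have "h 0 = 0" "h 1 = 1"
    using assms by (auto simp: h_def G_one)
  ultimately obtain s where s: "0 \<le> s" "s \<le> 1" "h s = real r * \<alpha> / real n"
    using IVT'[of h 0 "real r * \<alpha> / real n" 1] target by auto
  have "h 0 < h s" "h s < h 1"
    unfolding s(3) \<open>h 0 = 0\<close> \<open>h 1 = 1\<close> by (rule target)+
  then have "s \<noteq> 0" "s \<noteq> 1" by auto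
  then have s01: "0 < s" "s < 1"
    using s(1,2) by auto
  have "level k n \<alpha> u \<le> r \<longleftrightarrow> u \<le> s" if "u \<in> {0<..<1}" for u
  proof -
    have iff: "level k n \<alpha> u \<le> r \<longleftrightarrow> h u \<le> h s"
      unfolding s(3) unfolding h_def using assms(2,3,5,6) by (intro level_le_iff) auto
    show ?thesis
    proof (cases "u \<le> s")
      case True
      then have "h u \<le> h s"
        unfolding h_def using that s by (intro mult_mono G_mono G_nonneg) auto
      then show ?thesis using iff True by simp
    next
      case False
      \<comment> \<open>Positivity makes the crossing at \<open>s\<close> strict.\<close>
      have "0 < G (k - 1) (n - 1) s"
        using assms s01 by (intro G_pos) auto
      then have "h s < u * G (k - 1) (n - 1) s"
        using False by (simp add: h_def)
      also have "\<dots> \<le> h u"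
        unfolding h_def using that s False by (intro mult_left_mono G_mono) auto
      finally show ?thesis using iff False by simp
    qed
  qed
  then have "{0<..<1} \<inter> {u. level k n \<alpha> u \<le> r} = {0<..s}"
    using s01 by auto
  moreover have "{u. level k n \<alpha> u \<le> r} \<in> sets borel"
    using measurable_sets[OF level_measurable[of k n \<alpha>], of "{..r}"] by (simp add: vimage_def)
  ultimately have "t = s"
    using s01 unfolding t_def by (subst measure_uniform_measure) auto
  then show "0 < t" "t < 1" "t * G (k - 1) (n - 1) t = real r * \<alpha> / real n"
    using s01 s by (auto simp: h_def)
qed

section \<open>Order statistics and the rejected set\<close>

lemma order_stat_mono:
  assumes "1 \<le> i" "i \<le> j" "j \<le> n"
  shows "order_stat n x i \<le> order_stat n x j"
  unfolding order_stat_def using assms by (intro sorted_nth_mono) auto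

lemma l_hat_le: "l_hat k n \<alpha> x \<le> n"
  by (auto simp: l_hat_def Let_def)

text \<open>By \<open>level_le_iff\<close>, \<open>l_hat\<close> is the largest \<open>i\<close>
  whose order statistic has level at most \<open>i\<close>; the premise
  \<open>1 \<le> l_hat k n \<alpha> x\<close> excludes the default value \<open>0\<close>.\<close>

lemma level_order_stat_l_hat:
  assumes "0 < \<alpha>" "1 \<le> n"
  shows "1 \<le> l_hat k n \<alpha> x \<Longrightarrow> level k n \<alpha> (order_stat n x (l_hat k n \<alpha> x)) \<le> l_hat k n \<alpha> x"
    and "l_hat k n \<alpha> x < i \<Longrightarrow> i \<le> n \<Longrightarrow> i < level k n \<alpha> (order_stat n x i)"
proof -
  define S where "S = {i \<in> {1..n}. level k n \<alpha> (order_stat n x i) \<le> i}"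
  have "l_hat k n \<alpha> x = (if S = {} then 0 else Max S)"
    unfolding l_hat_def Let_def S_def
    using level_le_iff[OF assms] by (intro if_cong arg_cong[where f = Max] arg_cong2[where f = "(=)"] Collect_cong) auto
  moreover have "finite S" by (simp add: S_def)
  ultimately have in_S: "1 \<le> l_hat k n \<alpha> x \<Longrightarrow> l_hat k n \<alpha> x \<in> S"
    and le: "\<And>i. i \<in> S \<Longrightarrow> i \<le> l_hat k n \<alpha> x"
    using Max_in[of S] by (auto split: if_splits)
  show "level k n \<alpha> (order_stat n x (l_hat k n \<alpha> x)) \<le> l_hat k n \<alpha> x" if "1 \<le> l_hat k n \<alpha> x"
    using in_S[OF that] by (simp add: S_def)
  show "i < level k n \<alpha> (order_stat n x i)" if "l_hat k n \<alpha> x < i" "i \<le> n"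
  proof -
    have "i \<notin> S" using le[of i] that by auto
    then show ?thesis using that by (simp add: S_def)
  qed
qed

text \<open>Levels are monotone in the p-values, so ranks up to \<open>R\<close> have level at most
  \<open>R\<close>, while a rank \<open>i > R\<close> has level above \<open>i\<close>. The rejected
  set is thus described by levels alone, whatever the choice \<open>\<sigma>\<close> among
  ties.\<close>

lemma procedure1_eq_level:
  fixes k n :: nat
  assumes "0 < \<alpha>" "1 \<le> n" and x: "\<And>i. i \<in> {1..n} \<Longrightarrow> x i \<in> {0..1}"
    and \<sigma>: "orders_hypotheses n x \<sigma>"
  defines "R \<equiv> l_hat k n \<alpha> x" and "N \<equiv> \<lambda>l. {j \<in> {1..n}. level k n \<alpha> (x j) \<le> l}"
  shows "card (procedure1 k n \<alpha> x \<sigma>) = R"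
    and "1 \<le> R \<Longrightarrow> procedure1 k n \<alpha> x \<sigma> = N R"
    and "R < l \<Longrightarrow> l \<le> n \<Longrightarrow> card (N l) < l"
proof -
  have bij: "bij_betw \<sigma> {1..n} {1..n}" and ord: "\<And>i. i \<in> {1..n} \<Longrightarrow> x (\<sigma> i) = order_stat n x i"
    using \<sigma> by (auto simp: orders_hypotheses_def)
  have above: "i < level k n \<alpha> (x (\<sigma> i))" if "R < i" "i \<le> n" for i
    using level_order_stat_l_hat(2)[OF assms(1,2), where k = k and x = x, of i] that ord[of i] by (simp add: R_def)
  have image: "N l = \<sigma> ` {i \<in> {1..n}. level k n \<alpha> (x (\<sigma> i)) \<le> l}" for l
    using bij by (fastforce simp: N_def bij_betw_def)
  have "R \<le> n" by (simp add: R_def l_hat_le)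
  then show "card (procedure1 k n \<alpha> x \<sigma>) = R"
    using bij unfolding procedure1_def R_def[symmetric]
    by (subst card_image) (auto simp: bij_betw_def intro: inj_on_subset)
  show "procedure1 k n \<alpha> x \<sigma> = N R" if "1 \<le> R"
  proof -
    have "level k n \<alpha> (x (\<sigma> i)) \<le> R \<longleftrightarrow> i \<le> R" if "i \<in> {1..n}" for i
    proof (cases "i \<le> R")
      case True
      have "x (\<sigma> i) \<le> x (\<sigma> R)"
        using order_stat_mono[of i R n x] that True \<open>R \<le> n\<close> ord[of i] ord[of R] by auto
      moreover have "\<sigma> i \<in> {1..n}" "\<sigma> R \<in> {1..n}"
        using that True \<open>R \<le> n\<close> \<open>1 \<le> R\<close> bij by (auto dest!: bij_betwE)
      ultimately have "level k n \<alpha> (x (\<sigma> i)) \<le> level k n \<alpha> (x (\<sigma> R))"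
        using x[of "\<sigma> i"] x[of "\<sigma> R"] assms(1) by (intro level_mono) auto
      also have "\<dots> \<le> R"
        using level_order_stat_l_hat(1)[OF assms(1,2), where k = k and x = x] \<open>1 \<le> R\<close> \<open>R \<le> n\<close> ord[of R]
        by (simp add: R_def)
      finally show ?thesis using True by simp
    next
      case False
      then show ?thesis using above[of i] that by auto
    qed
    then have "{i \<in> {1..n}. level k n \<alpha> (x (\<sigma> i)) \<le> R} = {1..R}"
      using \<open>R \<le> n\<close> by auto
    then show ?thesis
      by (simp add: image procedure1_def R_def)
  qed
  show "card (N l) < l" if "R < l" "l \<le> n"
  proof -
    \<comment> \<open>Either \<open>i \<le> R < l\<close>, or \<open>i > R\<close> and then
      \<open>i\<close> is below its own level, which is at most \<open>l\<close>.\<close>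
    have "i < l" if "i \<in> {1..n}" "level k n \<alpha> (x (\<sigma> i)) \<le> l" for i
      using above[of i] that \<open>R < l\<close> by (cases "i < l") auto
    then have "N l \<subseteq> \<sigma> ` {1..<l}"
      unfolding image by (intro image_mono) auto
    then have "card (N l) \<le> card (\<sigma> ` {1..<l})"
      by (intro card_mono) auto
    also have "\<dots> \<le> card {1..<l}" by (rule card_image_le) simp
    also have "\<dots> < l" using that by simp
    finally show ?thesis .
  qed
qed

text \<open>The condition under which hypothesis \<open>i\<close>, being true and having level at most \<open>r\<close>, is one of exactly
  \<open>r\<close> rejected hypotheses, at least \<open>k\<close> of which are true. Here \<open>M\<close> and \<open>N\<close> are the levels
  of the other true null hypotheses and of the false ones; the level of \<open>i\<close> does not enter.\<close>

definition rejects_exactly :: "nat \<Rightarrow> nat \<Rightarrow> nat \<Rightarrow> nat multiset \<Rightarrow> nat multiset \<Rightarrow> bool" where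
  "rejects_exactly k n r M N \<longleftrightarrow> r \<le> Suc (num_in {..r} (M + N))
     \<and> (\<forall>l\<in>{r<..n}. Suc (num_in {..l} (M + N)) < l) \<and> k - 1 \<le> num_in {..r} M"

definition exact_rejection :: "nat \<Rightarrow> nat \<Rightarrow> nat set \<Rightarrow> nat \<Rightarrow> nat \<Rightarrow> (nat \<Rightarrow> nat) \<Rightarrow> bool" where
  "exact_rejection k n T i r f \<longleftrightarrow> rejects_exactly k n r
     (image_mset f (mset_set (T - {i}))) (image_mset f (mset_set ({1..n} - T)))"

section \<open>The loss as a sum of contributions of single true null hypotheses\<close>

text \<open>Each rejected true null hypothesis contributes \<open>1 / R\<close>. Summing over all
  \<open>r\<close> replaces the random \<open>R\<close> by fixed values: the term
  \<open>r = R\<close> accounts for the loss and the others are nonnegative.\<close>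

lemma loss_le:
  fixes k n :: nat
  assumes "0 < \<alpha>" "1 \<le> k" "k \<le> n" and x: "\<And>i. i \<in> {1..n} \<Longrightarrow> x i \<in> {0..1}"
    and T: "T \<subseteq> {1..n}" and \<sigma>: "orders_hypotheses n x \<sigma>"
  defines "A \<equiv> procedure1 k n \<alpha> x \<sigma>" and "f \<equiv> \<lambda>j. level k n \<alpha> (x j)"
  shows "real (card (A \<inter> T)) * of_bool (k \<le> card (A \<inter> T)) / real (max (card A) 1)
    \<le> (\<Sum>i\<in>T. \<Sum>r=1..n. of_bool (f i \<le> r) * of_bool (exact_rejection k n T i r f) / real r)"
proof (cases "k \<le> card (A \<inter> T)")
  case False
  then show ?thesis by (auto intro!: sum_nonneg)
next
  case True
  have "1 \<le> n" using assms by simp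
  define R where "R = l_hat k n \<alpha> x"
  have [simp]: "finite T" using T finite_subset by blast
  have cardA: "card A = R"
    unfolding A_def R_def by (rule procedure1_eq_level(1)[OF assms(1) \<open>1 \<le> n\<close> x \<sigma>])
  have "card (A \<inter> T) \<noteq> 0" using True assms(2) by linarith
  then have "A \<inter> T \<noteq> {}" by (metis card.empty)
  then have "A \<noteq> {}" by blast
  have "1 \<le> R"
  proof (rule ccontr)
    assume "\<not> 1 \<le> R"
    then show False using \<open>A \<noteq> {}\<close> by (simp add: A_def R_def procedure1_def)
  qed
  have A: "A = {j \<in> {1..n}. f j \<le> R}"
    unfolding A_def R_def f_def
    using procedure1_eq_level(2)[OF assms(1) \<open>1 \<le> n\<close> x \<sigma>, where k = k] \<open>1 \<le> R\<close> by (simp add: R_def)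
  have above: "card {j \<in> {1..n}. f j \<le> l} < l" if "R < l" "l \<le> n" for l
    unfolding f_def
    using procedure1_eq_level(3)[OF assms(1) \<open>1 \<le> n\<close> x \<sigma>, where k = k and l = l] that by (simp add: R_def)
  have "R \<le> n" by (simp add: R_def l_hat_le)
  have exact: "exact_rejection k n T i R f" if i: "i \<in> T" "f i \<le> R" for i
  proof -
    \<comment> \<open>The \<open>Suc\<close> counts hypothesis \<open>i\<close> itself, whose level
      is at most \<open>R\<close> and so at most \<open>l\<close>.\<close>
    have others: "Suc (num_in {..l} (image_mset f (mset_set (T - {i})) + image_mset f (mset_set ({1..n} - T))))
        = card {j \<in> {1..n}. f j \<le> l}" if "R \<le> l" for l
    proof -
      have "{j \<in> {1..n}. f j \<le> l} = insert i ({j \<in> T - {i}. f j \<le> l} \<union> {j \<in> {1..n} - T. f j \<le> l})"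
        using T i that by auto
      moreover have "card ({j \<in> T - {i}. f j \<le> l} \<union> {j \<in> {1..n} - T. f j \<le> l})
          = card {j \<in> T - {i}. f j \<le> l} + card {j \<in> {1..n} - T. f j \<le> l}"
        by (rule card_Un_disjoint) auto
      moreover have "i \<notin> {j \<in> T - {i}. f j \<le> l} \<union> {j \<in> {1..n} - T. f j \<le> l}"
        using i by auto
      ultimately show ?thesis
        by (simp add: num_in_image_mset_set)
    qed
    have "A \<inter> T = insert i {j \<in> T - {i}. f j \<le> R}"
      using i T A by auto
    then have "card (A \<inter> T) = Suc (card {j \<in> T - {i}. f j \<le> R})"
      by simp
    then have "k - 1 \<le> num_in {..R} (image_mset f (mset_set (T - {i})))"
      using True by (simp add: num_in_image_mset_set)
    then show ?thesis
      unfolding exact_rejection_def rejects_exactly_def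
      using others above cardA A by auto
  qed
  have "A \<inter> T = {i \<in> T. f i \<le> R}" using A T by auto
  then have count: "real (card (A \<inter> T)) = (\<Sum>i\<in>T. of_bool (f i \<le> R))"
    by (simp add: of_bool_def sum.If_cases Int_def)
  then have "real (card (A \<inter> T)) * of_bool (k \<le> card (A \<inter> T)) / real (max (card A) 1)
      = real (card (A \<inter> T)) / real R"
    using True \<open>1 \<le> R\<close> cardA by simp
  also have "\<dots> = (\<Sum>i\<in>T. of_bool (f i \<le> R) / real R)"
    by (simp only: count sum_divide_distrib)
  also have "\<dots> \<le> (\<Sum>i\<in>T. \<Sum>r=1..n. of_bool (f i \<le> r) * of_bool (exact_rejection k n T i r f) / real r)"
  proof (rule sum_mono)
    fix i assume "i \<in> T"
    then have "of_bool (f i \<le> R) / real R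
        \<le> of_bool (f i \<le> R) * of_bool (exact_rejection k n T i R f) / real R"
      using exact[of i] by auto
    also have "\<dots> \<le> (\<Sum>r=1..n. of_bool (f i \<le> r) * of_bool (exact_rejection k n T i r f) / real r)"
      using \<open>1 \<le> R\<close> \<open>R \<le> n\<close>
      by (intro member_le_sum[of R "{1..n}" "\<lambda>r. of_bool (f i \<le> r) * of_bool (exact_rejection k n T i r f) / real r"]) auto
    finally show "of_bool (f i \<le> R) / real R
        \<le> (\<Sum>r=1..n. of_bool (f i \<le> r) * of_bool (exact_rejection k n T i r f) / real r)" .
  qed
  finally show ?thesis .
qed

lemma exact_rejection_cong:
  assumes "\<And>j. j \<in> T - {i} \<union> ({1..n} - T) \<Longrightarrow> f j = g j" "finite T"
  shows "exact_rejection k n T i r f \<longleftrightarrow> exact_rejection k n T i r g"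
proof -
  have "image_mset f (mset_set (T - {i})) = image_mset g (mset_set (T - {i}))"
    "image_mset f (mset_set ({1..n} - T)) = image_mset g (mset_set ({1..n} - T))"
    using assms by (auto intro!: image_mset_cong)
  then show ?thesis by (simp add: exact_rejection_def)
qed

text \<open>The level of \<open>i\<close> is independent of the others and factors out as
  \<open>sum (w i) {..r}\<close>. Dividing by \<open>r\<close> turns it into
  \<open>\<alpha> / n\<close> over a binomial tail, and \<open>step_up_sum_le_1\<close> applies for
  each fixed choice of levels of the false null hypotheses.\<close>

lemma sum_exact_rejection_le:
  fixes w :: "nat \<Rightarrow> nat \<Rightarrow> real"
  assumes k: "1 \<le> k" "k \<le> n" and "0 < \<alpha>" and T: "T \<subseteq> {1..n}" "i \<in> T"
    and w: "\<And>j x. 0 \<le> w j x" "\<And>j. j \<in> {1..n} \<Longrightarrow> sum (w j) {..Suc n} = 1"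
    and eq: "\<And>j. j \<in> T \<Longrightarrow> w j = w i"
    and t: "\<And>r. 1 \<le> r \<Longrightarrow> r \<le> n \<Longrightarrow> 0 < sum (w i) {..r}"
      "\<And>r. 1 \<le> r \<Longrightarrow> r \<le> n \<Longrightarrow> sum (w i) {..r} < 1"
      "\<And>r. 1 \<le> r \<Longrightarrow> r \<le> n \<Longrightarrow> sum (w i) {..r} * G (k - 1) (n - 1) (sum (w i) {..r}) = real r * \<alpha> / real n"
  shows "(\<Sum>r=1..n. mean_prod {1..n} {..Suc n} w
            (\<lambda>f. of_bool (f i \<le> r) * of_bool (exact_rejection k n T i r f)) / real r) \<le> \<alpha> / real n"
proof -
  define F where "F = {1..n} - T"
  define L where "L f = image_mset f (mset_set F)" for f :: "nat \<Rightarrow> nat"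
  define Z where "Z r N = mean_sample {..Suc n} (w i) (card T - 1) (\<lambda>M. of_bool (rejects_exactly k n r M N))" for r N
  have [simp]: "finite T" using T finite_subset by blast
  have I: "{1..n} = insert i (T - {i} \<union> F)" using T by (auto simp: F_def)
  have i: "i \<notin> T - {i} \<union> F" using T by (auto simp: F_def)
  have mean: "mean_prod {1..n} {..Suc n} w (\<lambda>f. of_bool (f i \<le> r) * of_bool (exact_rejection k n T i r f))
      = sum (w i) {..r} * mean_prod F {..Suc n} w (\<lambda>f. Z r (L f))" if r: "r \<le> n" for r
  proof -
    have upd: "exact_rejection k n T i r (f(i := x)) = exact_rejection k n T i r f" for f x
      using i by (intro exact_rejection_cong) (auto simp: F_def)
    have "mean_prod {1..n} {..Suc n} w (\<lambda>f. of_bool (f i \<le> r) * of_bool (exact_rejection k n T i r f))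
        = (\<Sum>x\<le>Suc n. w i x * mean_prod (T - {i} \<union> F) {..Suc n} w
            (\<lambda>f. of_bool ((f(i := x)) i \<le> r) * of_bool (exact_rejection k n T i r (f(i := x)))))"
      unfolding I by (rule mean_prod_insert[OF _ i]) (simp add: F_def)
    also have "\<dots> = (\<Sum>x\<le>Suc n. w i x * (of_bool (x \<le> r) *
            mean_prod (T - {i} \<union> F) {..Suc n} w (\<lambda>f. of_bool (exact_rejection k n T i r f))))"
      by (simp only: upd fun_upd_same mean_prod_cmult)
    also have "mean_prod (T - {i} \<union> F) {..Suc n} w (\<lambda>f. of_bool (exact_rejection k n T i r f))
        = mean_prod F {..Suc n} w (\<lambda>f. Z r (L f))"
    proof -
      have "card (T - {i}) = card T - 1" using T by simp
      then show ?thesis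
        unfolding exact_rejection_def F_def[symmetric] Z_def L_def
        using mean_prod_iid[of "T - {i}" F w "w i" "{..Suc n}" "\<lambda>M N. of_bool (rejects_exactly k n r M N)"] eq
        by (auto simp: F_def)
    qed
    also have "(\<Sum>x\<le>Suc n. w i x * (of_bool (x \<le> r) * mean_prod F {..Suc n} w (\<lambda>f. Z r (L f))))
        = (\<Sum>x\<le>r. w i x * mean_prod F {..Suc n} w (\<lambda>f. Z r (L f)))"
      using r by (intro sum.mono_neutral_cong_right) auto
    finally show ?thesis by (simp add: sum_distrib_right)
  qed
  have "(\<Sum>r=1..n. mean_prod {1..n} {..Suc n} w
            (\<lambda>f. of_bool (f i \<le> r) * of_bool (exact_rejection k n T i r f)) / real r)
      = (\<Sum>r=1..n. (\<alpha> / real n) * mean_prod F {..Suc n} w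
            (\<lambda>f. (1 / G (k - 1) (n - 1) (sum (w i) {..r})) * Z r (L f)))"
  proof (rule sum.cong[OF refl])
    fix r assume r: "r \<in> {1..n}"
    then have "G (k - 1) (n - 1) (sum (w i) {..r}) > 0"
      using k t(1,2)[of r] by (intro G_pos) auto
    then have "sum (w i) {..r} / real r = (\<alpha> / real n) * (1 / G (k - 1) (n - 1) (sum (w i) {..r}))"
      using t(3)[of r] r by (simp add: field_simps)
    moreover have "mean_prod {1..n} {..Suc n} w
            (\<lambda>f. of_bool (f i \<le> r) * of_bool (exact_rejection k n T i r f)) / real r
        = (sum (w i) {..r} / real r) * mean_prod F {..Suc n} w (\<lambda>f. Z r (L f))"
      using mean[of r] r by simp
    ultimately show "mean_prod {1..n} {..Suc n} w
            (\<lambda>f. of_bool (f i \<le> r) * of_bool (exact_rejection k n T i r f)) / real r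
        = (\<alpha> / real n) * mean_prod F {..Suc n} w
            (\<lambda>f. (1 / G (k - 1) (n - 1) (sum (w i) {..r})) * Z r (L f))"
      by (simp only: mean_prod_cmult mult.assoc)
  qed
  also have "\<dots> = (\<alpha> / real n) * mean_prod F {..Suc n} w
      (\<lambda>f. \<Sum>r=1..n. Z r (L f) / G (k - 1) (n - 1) (sum (w i) {..r}))"
    by (simp add: sum_distrib_left mean_prod_sum)
  also have "\<dots> \<le> (\<alpha> / real n) * mean_prod F {..Suc n} w (\<lambda>_. 1)"
  proof (intro mult_left_mono mean_prod_mono w(1))
    fix f
    \<comment> \<open>The assumptions \<open>t\<close> start at \<open>r = 1\<close>; the value
      \<open>r = 0\<close> is covered by monotonicity.\<close>
    have "sum (w i) {..r} < 1" if "r \<le> n" for r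
    proof -
      have "sum (w i) {..r} \<le> sum (w i) {..max r 1}"
        using w by (intro sum_mono2) auto
      also have "\<dots> < 1" using t(2)[of "max r 1"] that k by simp
      finally show ?thesis .
    qed
    moreover have "card T \<le> n" using card_mono[OF _ T(1)] by simp
    ultimately show "(\<Sum>r=1..n. Z r (L f) / G (k - 1) (n - 1) (sum (w i) {..r})) \<le> 1"
      \<comment> \<open>Used with \<open>c = k - 1\<close>, \<open>m = card T - 1\<close> and
        \<open>m' = n - 1\<close>.\<close>
      unfolding Z_def rejects_exactly_def using w t(1) T k by (intro step_up_sum_le_1) auto
  qed (use \<open>0 < \<alpha>\<close> in simp)
  also have "mean_prod F {..Suc n} w (\<lambda>_. 1) = 1"
    using w by (intro mean_prod_one) (auto simp: F_def)
  finally show ?thesis by simp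
qed

section \<open>Passage from p-values to independent levels\<close>

theorem theorem4p1:
  fixes M :: "'a measure" and p :: "nat \<Rightarrow> 'a \<Rightarrow> real" and T :: "nat set"
    and k n :: nat and \<alpha> :: real and \<sigma> :: "'a \<Rightarrow> nat \<Rightarrow> nat"
  assumes "prob_space M"
    and "1 \<le> k" and "k \<le> n"
    and "0 < \<alpha>" and "\<alpha> < 1"
    and "T \<subseteq> {1..n}"
    and "\<And>i \<omega>. i \<in> {1..n} \<Longrightarrow> \<omega> \<in> space M \<Longrightarrow> p i \<omega> \<in> {0..1}"
    and "prob_space.indep_vars M (\<lambda>_. borel) p {1..n}"
    and "\<And>i. i \<in> T \<Longrightarrow> distr M borel (p i) = uniform_measure lborel {0<..<1}"
    and "\<And>\<omega>. \<omega> \<in> space M \<Longrightarrow> orders_hypotheses n (\<lambda>i. p i \<omega>) (\<sigma> \<omega>)"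
  shows "kFDR M T k (\<lambda>\<omega>. procedure1 k n \<alpha> (\<lambda>i. p i \<omega>) (\<sigma> \<omega>)) \<le> \<alpha>"
proof -
  interpret prob_space M by fact
  note T = \<open>T \<subseteq> {1..n}\<close>
  \<comment> \<open>Levels inherit independence from the p-values and lie in
    \<open>{..Suc n}\<close>, so expectations become finite sums.\<close>
  define X where "X i \<omega> = level k n \<alpha> (p i \<omega>)" for i \<omega>
  define w where "w i x = prob (X i -` {x} \<inter> space M)" for i x
  have [simp]: "finite T" using T finite_subset by blast
  have p: "random_variable borel (p i)" if "i \<in> {1..n}" for i
    using assms(8) that by (auto simp: indep_vars_def)
  have X: "random_variable (count_space UNIV) (X i)" if "i \<in> {1..n}" for i
    unfolding X_def[abs_def] by (rule measurable_compose[OF p[OF that] level_measurable])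
  have indep: "indep_vars (\<lambda>_. count_space UNIV) X {1..n}"
    unfolding X_def[abs_def] by (rule indep_vars_compose2[OF assms(8)]) (rule level_measurable)
  have sum_w: "sum (w i) {..r} = prob (X i -` {..r} \<inter> space M)" if "i \<in> {1..n}" for i r
  proof -
    interpret D: prob_space "distr M (count_space UNIV) (X i)"
      by (rule prob_space_distr[OF X[OF that]])
    have "measure (distr M (count_space UNIV) (X i)) {..r}
        = (\<Sum>x\<le>r. measure (distr M (count_space UNIV) (X i)) {x})"
      by (rule D.finite_measure_eq_sum_singleton) auto
    then show ?thesis
      by (simp add: w_def measure_distr[OF X[OF that]])
  qed
  have w_one: "sum (w i) {..Suc n} = 1" if "i \<in> {1..n}" for i
  proof -
    have "X i -` {..Suc n} \<inter> space M = space M" by (auto simp: X_def level_bound)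
    then show ?thesis using prob_space by (simp only: sum_w[OF that])
  qed
  have prob_T: "prob (X i -` B \<inter> space M)
      = measure (uniform_measure lborel {0<..<1}) {u. level k n \<alpha> u \<in> B}" if "i \<in> T" for i B
  proof -
    have "{u. level k n \<alpha> u \<in> B} \<in> sets borel"
      using measurable_sets[OF level_measurable[of k n \<alpha>], of B] by (simp add: vimage_def)
    then have "measure (distr M borel (p i)) {u. level k n \<alpha> u \<in> B} = prob (X i -` B \<inter> space M)"
      using that T by (subst measure_distr[OF p]) (auto simp: X_def vimage_def)
    then show ?thesis using assms(9)[OF that] by simp
  qed
  define H where "H i r f = of_bool (f i \<le> r) * of_bool (exact_rejection k n T i r f) / real r"
    for i r and f :: "nat \<Rightarrow> nat"
  have H: "has_bochner_integral M (\<lambda>\<omega>. H i r (\<lambda>j. X j \<omega>)) (mean_prod {1..n} {..Suc n} w (H i r))"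
    if "i \<in> T" for i r
    unfolding w_def
  proof (rule expectation_indep_vars_finite_range[OF indep])
    show "H i r f = H i r g" if "\<And>j. j \<in> {1..n} \<Longrightarrow> f j = g j" for f g
      using that[of i] exact_rejection_cong[of T i n f g k r] that T \<open>i \<in> T\<close> by (auto simp: H_def subset_iff)
  qed (use assms in \<open>auto simp: X_def level_bound\<close>)
  have HS: "has_bochner_integral M (\<lambda>\<omega>. \<Sum>i\<in>T. \<Sum>r=1..n. H i r (\<lambda>j. X j \<omega>))
      (\<Sum>i\<in>T. \<Sum>r=1..n. mean_prod {1..n} {..Suc n} w (H i r))"
    by (intro has_bochner_integral_sum H)
  have "kFDR M T k (\<lambda>\<omega>. procedure1 k n \<alpha> (\<lambda>i. p i \<omega>) (\<sigma> \<omega>))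
      \<le> (LINT \<omega>|M. (\<Sum>i\<in>T. \<Sum>r=1..n. H i r (\<lambda>j. X j \<omega>)))"
    unfolding kFDR_def Let_def
  \<comment> \<open>Integrability is asked of the upper bound only, together with its nonnegativity;
    the loss, with its arbitrary choice \<open>\<sigma>\<close> among ties, is compared
    pointwise.\<close>
  proof (rule integral_mono')
    show "integrable M (\<lambda>\<omega>. \<Sum>i\<in>T. \<Sum>r=1..n. H i r (\<lambda>j. X j \<omega>))"
      using HS by (rule integrable.intros)
  next
    fix \<omega> assume "\<omega> \<in> space M"
    then show "real (card (procedure1 k n \<alpha> (\<lambda>i. p i \<omega>) (\<sigma> \<omega>) \<inter> T))
        * of_bool (k \<le> card (procedure1 k n \<alpha> (\<lambda>i. p i \<omega>) (\<sigma> \<omega>) \<inter> T))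
        / real (max (card (procedure1 k n \<alpha> (\<lambda>i. p i \<omega>) (\<sigma> \<omega>))) 1)
        \<le> (\<Sum>i\<in>T. \<Sum>r=1..n. H i r (\<lambda>j. X j \<omega>))"
      unfolding H_def X_def using assms by (intro loss_le) auto
  qed (auto intro!: sum_nonneg simp: H_def)
  also have "\<dots> = (\<Sum>i\<in>T. \<Sum>r=1..n. mean_prod {1..n} {..Suc n} w (H i r))"
    by (rule has_bochner_integral_integral_eq[OF HS])
  also have "\<dots> \<le> (\<Sum>i\<in>T. \<alpha> / real n)"
  proof (rule sum_mono)
    fix i assume i: "i \<in> T"
    then have "i \<in> {1..n}" using T by auto
    have t: "sum (w i) {..r} = measure (uniform_measure lborel {0<..<1}) {u. level k n \<alpha> u \<le> r}" for r
      using sum_w[OF \<open>i \<in> {1..n}\<close>] prob_T[OF i, of "{..r}"] by simp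
    have "(\<Sum>r=1..n. mean_prod {1..n} {..Suc n} w
            (\<lambda>f. of_bool (f i \<le> r) * of_bool (exact_rejection k n T i r f)) / real r) \<le> \<alpha> / real n"
    proof (rule sum_exact_rejection_le[OF assms(2,3,4) T i])
      show "w j = w i" if "j \<in> T" for j
        using prob_T[OF that] prob_T[OF i] by (simp add: w_def fun_eq_iff)
    qed (use w_one uniform_level[OF assms(2-5)] in \<open>auto simp: t, simp add: w_def\<close>)
    moreover have "mean_prod {1..n} {..Suc n} w (H i r) = mean_prod {1..n} {..Suc n} w
            (\<lambda>f. of_bool (f i \<le> r) * of_bool (exact_rejection k n T i r f)) / real r" for r
      unfolding H_def[abs_def]
      using mean_prod_cmult[of "{1..n}" "{..Suc n}" w "1 / real r"
          "\<lambda>f. of_bool (f i \<le> r) * of_bool (exact_rejection k n T i r f)"] by simp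
    ultimately show "(\<Sum>r=1..n. mean_prod {1..n} {..Suc n} w (H i r)) \<le> \<alpha> / real n"
      by simp
  qed
  also have "\<dots> = real (card T) * \<alpha> / real n"
    by simp
  also have "\<dots> \<le> \<alpha>"
  proof -
    have "card T \<le> n" using card_mono[OF _ T] by simp
    then have "real (card T) * \<alpha> \<le> real n * \<alpha>" using assms by simp
    then show ?thesis using assms by (simp add: field_simps)
  qed
  finally show ?thesis .
qed

end
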